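(* Consider nonconstant solutions $\theta$ of the boundary value problem (BVP) given in the context, with parameters $\tilde W_S>0$, $\tilde E_B\ge0$, $L/\xi\ge1$, $\kappa\in(0,1)$, and set $p_x(x)=\cos\theta(x)$. Let (H) denote the condition $$\tilde E_B<1\quad\text{and}\quad \tilde W_S>\max\left\{\sqrt{\tilde E_B^2+\frac{1+\kappa}{2}\left(\frac{\pi\xi}{L}\right)^2},\ \frac{\pi\xi}{L}\sqrt{\frac{1+\kappa}{2}\left(1+\frac{\kappa\tilde E_B^2}{1-\tilde E_B^2}\right)}\right\}.$$ 1. With $\tilde W_S$, $L/\xi$, $\kappa$ fixed, and for $\tilde E_B$ in the range where (H) holds, $p_x(0)$ increases as $\tilde E_B$ increases. When $\tilde E_B=0$, $\int_0^1p_x(x)\,dx=0$. As $\tilde E_B\to\infty$ (with $\tilde W_S$, $L/\xi$, $\kappa$ fixed), $\int_0^1p_x(x)\,dx\to1$. 2. If $\tilde E_B=0$ (with $L/\xi$, $\kappa$ fixed), then as $\tilde W_S$ increases from $0$ to $\infty$, $p_x(0)$ increases from $0$ to $1$ and $p_x(1)$ decreases from $0$ to $-1$ (the endpoint values being understood as limits as $\tilde W_S\to0^+$ and $\tilde W_S\to\infty$). 3. With $\tilde E_B$, $\tilde W_S$, $\kappa$ fixed, and for $L/\xi$ in the range where (H) holds, if $L/\xi$ increases then $p_x(0)$ increases and $p_x(1)$ decreases.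
   Context: Parameters: $\tilde W_S$ (surface anchoring strength), $\tilde E_B$ (bias field), $L/\xi$ (ratio of cell thickness to correlation length, $L,\xi>0$), $\kappa$ (bend-to-splay ratio) are real numbers with $\tilde W_S>0$, $\tilde E_B\ge0$, $L/\xi\ge1$, $\kappa\in(0,1)$. (BVP): the Euler-Lagrange equation $$(\sin^2\theta+\kappa\cos^2\theta)\theta''+\tfrac12(1-\kappa)\sin 2\theta\,(\theta')^2+\tfrac12\left(\tfrac{L}{\xi}\right)^2\sin2\theta-\tilde E_B\left(\tfrac L\xi\right)^2\sin\theta=0\quad\text{on }(0,1)$$ with the nonlinear boundary conditions $$-\tilde W_S\left(\tfrac L\xi\right)\sin\theta+(\sin^2\theta+\kappa\cos^2\theta)\theta'=0\quad\text{at }x=0\text{ and }x=1.$$ A solution is a (smooth) function $\theta:[0,1]\to[0,\pi]$ satisfying the equation and both boundary conditions. Meaning of monotonicity: "a quantity $q$ increases (decreases) as a parameter increases" means that if two values $a<b$ of that parameter are in the stated range, all other parameters being equal, then the value of $q$ for a nonconstant solution with parameter $b$ is larger (smaller) than its value for a nonconstant solution with parameter $a$. "As $\tilde E_B\to\infty$, $\int p_x\to1$" is likewise understood for nonconstant solutions with the corresponding parameters. *)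

theory Defs
  imports "HOL-Analysis.Analysis"
begin

text \<open>
  Throughout, \<open>W\<close> is the anchoring strength, \<open>E\<close> the bias field, \<open>l\<close> the ratio
  \<open>L/\<xi>\<close> (so \<open>\<pi>\<xi>/L\<close> is \<open>pi / l\<close>), and \<open>\<kappa>\<close> the bend-to-splay ratio.
\<close>

text \<open>
  Only the values of a function on \<open>[0,1]\<close> matter: the derivative is two-sided on
  \<open>(0,1)\<close> and one-sided at the two endpoints.
\<close>

definition deriv01 :: "(real \<Rightarrow> real) \<Rightarrow> real \<Rightarrow> real" where
  "deriv01 f x = vector_derivative f (at x within {0..1})"

definition smooth01 :: "(real \<Rightarrow> real) \<Rightarrow> bool" where
  "smooth01 f \<longleftrightarrow> (\<forall>n. (deriv01 ^^ n) f differentiable_on {0..1})"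

definition elastic :: "real \<Rightarrow> real \<Rightarrow> real" where
  "elastic \<kappa> t = (sin t)\<^sup>2 + \<kappa> * (cos t)\<^sup>2"

definition euler_lagrange :: "real \<Rightarrow> real \<Rightarrow> real \<Rightarrow> (real \<Rightarrow> real) \<Rightarrow> real \<Rightarrow> bool" where
  "euler_lagrange E l \<kappa> \<theta> x \<longleftrightarrow>
     elastic \<kappa> (\<theta> x) * deriv01 (deriv01 \<theta>) x
       + 1/2 * (1 - \<kappa>) * sin (2 * \<theta> x) * (deriv01 \<theta> x)\<^sup>2
       + 1/2 * l\<^sup>2 * sin (2 * \<theta> x)
       - E * l\<^sup>2 * sin (\<theta> x) = 0"

definition boundary_cond :: "real \<Rightarrow> real \<Rightarrow> real \<Rightarrow> (real \<Rightarrow> real) \<Rightarrow> real \<Rightarrow> bool" where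
  "boundary_cond W l \<kappa> \<theta> x \<longleftrightarrow>
     - W * l * sin (\<theta> x) + elastic \<kappa> (\<theta> x) * deriv01 \<theta> x = 0"

definition bvp_solution :: "real \<Rightarrow> real \<Rightarrow> real \<Rightarrow> real \<Rightarrow> (real \<Rightarrow> real) \<Rightarrow> bool" where
  "bvp_solution W E l \<kappa> \<theta> \<longleftrightarrow>
     smooth01 \<theta> \<and> \<theta> ` {0..1} \<subseteq> {0..pi} \<and>
     (\<forall>x\<in>{0<..<1}. euler_lagrange E l \<kappa> \<theta> x) \<and>
     boundary_cond W l \<kappa> \<theta> 0 \<and> boundary_cond W l \<kappa> \<theta> 1"

definition nonconst_solution :: "real \<Rightarrow> real \<Rightarrow> real \<Rightarrow> real \<Rightarrow> (real \<Rightarrow> real) \<Rightarrow> bool" where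
  "nonconst_solution W E l \<kappa> \<theta> \<longleftrightarrow>
     bvp_solution W E l \<kappa> \<theta> \<and> \<not> \<theta> constant_on {0..1}"

definition px :: "(real \<Rightarrow> real) \<Rightarrow> real \<Rightarrow> real" where
  "px \<theta> x = cos (\<theta> x)"

definition cond_H :: "real \<Rightarrow> real \<Rightarrow> real \<Rightarrow> real \<Rightarrow> bool" where
  "cond_H W E l \<kappa> \<longleftrightarrow> E < 1 \<and>
     W > max (sqrt (E\<^sup>2 + (1 + \<kappa>) / 2 * (pi / l)\<^sup>2))
             (pi / l * sqrt ((1 + \<kappa>) / 2 * (1 + \<kappa> * E\<^sup>2 / (1 - E\<^sup>2))))"

text \<open>
  A quantity \<open>q\<close> of the elements of \<open>S a\<close> tends to \<open>c\<close> as \<open>a\<close> runs along \<open>F\<close>, uniformly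
  in the choice of the element of \<open>S a\<close>.  No element of \<open>S a\<close> is claimed to exist.
\<close>

definition tends_on :: "('a \<Rightarrow> 'b \<Rightarrow> bool) \<Rightarrow> ('b \<Rightarrow> real) \<Rightarrow> real \<Rightarrow> 'a filter \<Rightarrow> bool" where
  "tends_on S q c F \<longleftrightarrow> (\<forall>\<epsilon>>0. \<forall>\<^sub>F a in F. \<forall>s. S a s \<longrightarrow> \<bar>q s - c\<bar> < \<epsilon>)"

end

theory Submission
  imports Defs
begin

text \<open>
  A nonconstant solution is strictly increasing: at a critical point it is not at an equilibrium,
  so an interior maximum would have a smaller angle than an interior minimum to its right.
  The first integral together with the boundary conditions then gives the speed as a function of
  the angle and of \<open>p\<^sub>x(0)\<close> alone, and a strictly monotone relation between \<open>p\<^sub>x(0)\<close> and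
  \<open>p\<^sub>x(1)\<close>.  If the start \<open>p\<^sub>x(0)\<close> failed to increase with a parameter, the second solution would
  traverse a smaller range of angles at a larger speed, but both take the same time \<open>1\<close>.
\<close>

text \<open>Profiles with different parameters are compared at equal angle, not at equal
  \<open>x\<close>: there the elastic factor depends only on the common \<kappa> and cancels, so
  only an inequality between functions of \<open>cos\<close> remains. The travel time would be the
  integral of the reciprocal speed; following the inverse of one profile along the other avoids that
  change of variables. This comparison is weak and yields only that the two profiles are equal.
  Strictness is recovered at the boundary: equal profiles have equal end values, and equal initial
  slopes force equal \<open>W * l\<close>. The other obstacle is that a hypothesis on
  \<open>px \<theta> 0\<close> says nothing directly about the final angle. Equality of the levels
  at the two different ends reduces to \<open>chord = 2 * E\<close>, and \<open>chord\<close> is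
  strictly increasing in each argument. Hence, at fixed \<open>E\<close>, \<open>W\<close> and
  \<kappa>, a lower start comes with a higher end, which nests the angle ranges. The same fact shows
  that the level is largest at the start among all values above it, so the profile with the lower
  start is also the faster one.\<close>

section \<open>Real-variable tools: a Gronwall bound, interior extrema, comparison of increasing
  functions\<close>

text \<open>A two-sided Gronwall argument: \<open>exp (- L * x) * v x\<close> cannot grow to the
  right of \<open>a\<close>, and \<open>exp (L * x) * v x\<close> cannot grow to the left of
  it.\<close>

lemma zero_of_derivative_bound:
  fixes v v' :: "real \<Rightarrow> real"
  assumes v: "\<And>x. x \<in> {0..1} \<Longrightarrow> (v has_real_derivative v' x) (at x within {0..1})"
    and bound: "\<And>x. x \<in> {0..1} \<Longrightarrow> \<bar>v' x\<bar> \<le> L * v x"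
    and nonneg: "\<And>x. x \<in> {0..1} \<Longrightarrow> 0 \<le> v x"
    and a: "a \<in> {0..1}" "v a = 0"
    and x: "x \<in> {0..1}"
  shows "v x = 0"
proof -
  have cont: "continuous_on {0..1} v"
    using v by (meson DERIV_continuous continuous_on_eq_continuous_within)
  have at: "(v has_real_derivative v' y) (at y)" if "0 < y" "y < 1" for y
    using v[of y] that by (simp add: at_within_Icc_at)
  show ?thesis
  proof (cases "a \<le> x")
    case True
    have "exp (- L * x) * v x \<le> exp (- L * a) * v a"
    proof (rule DERIV_nonpos_imp_decreasing_open[OF True])
      show "continuous_on {a..x} (\<lambda>y. exp (- L * y) * v y)"
        using a x by (intro continuous_intros continuous_on_subset[OF cont]) auto
    next
      fix y assume y: "a < y" "y < x"
      have "((\<lambda>y. exp (- L * y) * v y) has_real_derivative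
              exp (- L * y) * (v' y - L * v y)) (at y)"
        using y a x by (auto intro!: derivative_eq_intros at simp: algebra_simps)
      moreover have "v' y \<le> L * v y"
        using bound[of y] y a x by auto
      ultimately show "\<exists>D. ((\<lambda>y. exp (- L * y) * v y) has_real_derivative D) (at y) \<and> D \<le> 0"
        by (intro exI conjI) (auto simp: mult_le_0_iff)
    qed
    then show ?thesis
      using a nonneg[OF x] by (simp add: mult_le_0_iff)
  next
    case False
    then have "x \<le> a" by simp
    have "exp (L * x) * v x \<le> exp (L * a) * v a"
    proof (rule DERIV_nonneg_imp_increasing_open[OF \<open>x \<le> a\<close>])
      show "continuous_on {x..a} (\<lambda>y. exp (L * y) * v y)"
        using a x by (intro continuous_intros continuous_on_subset[OF cont]) auto
    next
      fix y assume y: "x < y" "y < a"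
      have "((\<lambda>y. exp (L * y) * v y) has_real_derivative
              exp (L * y) * (v' y + L * v y)) (at y)"
        using y a x by (auto intro!: derivative_eq_intros at simp: algebra_simps)
      moreover have "- v' y \<le> L * v y"
        using bound[of y] y a x by auto
      ultimately show "\<exists>D. ((\<lambda>y. exp (L * y) * v y) has_real_derivative D) (at y) \<and> 0 \<le> D"
        by (intro exI conjI) auto
    qed
    then show ?thesis
      using a nonneg[OF x] by (simp add: mult_le_0_iff)
  qed
qed

lemma interior_max_derivatives:
  fixes f f' :: "real \<Rightarrow> real"
  assumes f: "\<And>x. b < x \<Longrightarrow> x < c \<Longrightarrow> (f has_real_derivative f' x) (at x)"
    and f': "(f' has_real_derivative D) (at a)"
    and a: "b < a" "a < c"
    and le: "\<And>x. b < x \<Longrightarrow> x < c \<Longrightarrow> f x \<le> f a"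
  shows "f' a = 0" "D \<le> 0"
proof -
  show *: "f' a = 0"
    by (rule DERIV_local_max[OF f[OF a], of "min (a - b) (c - a)"]) (use a in \<open>auto intro!: le\<close>)
  show "D \<le> 0"
  proof (rule ccontr)
    assume "\<not> D \<le> 0"
    then obtain d where d: "d > 0" "\<And>h. 0 < h \<Longrightarrow> h < d \<Longrightarrow> f' a < f' (a + h)"
      using DERIV_pos_inc_right[OF f'] by auto
    define h where "h = min d (c - a) / 2"
    have h: "0 < h" "h < d" "a + h < c"
      using d a by (auto simp: h_def min_def field_simps)
    then have "a < a + h" by simp
    have "f a < f (a + h)"
    proof (rule DERIV_pos_imp_increasing_open[OF \<open>a < a + h\<close>])
      fix x assume x: "a < x" "x < a + h"
      have "f' x > 0"
        using d(2)[of "x - a"] x h * by simp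
      then show "\<exists>y. (f has_real_derivative y) (at x) \<and> 0 < y"
        using f[of x] x a h by auto
    next
      show "continuous_on {a..a + h} f"
        using a h by (intro continuous_at_imp_continuous_on ballI DERIV_isCont[OF f]) auto
    qed
    with le[of "a + h"] h a show False by simp
  qed
qed

text \<open>
  The inverse of \<open>f\<close> composed with \<open>g\<close> maps the unit interval to itself and has slope at
  least \<open>1\<close>, so it is the identity.
\<close>

lemma slower_profile_eq:
  fixes f g f' g' :: "real \<Rightarrow> real"
  assumes f: "\<And>x. x \<in> {0..1} \<Longrightarrow> (f has_real_derivative f' x) (at x within {0..1})"
    and g: "\<And>x. x \<in> {0..1} \<Longrightarrow> (g has_real_derivative g' x) (at x within {0..1})"
    and f'_pos: "\<And>x. x \<in> {0..1} \<Longrightarrow> 0 < f' x"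
    and g'_pos: "\<And>x. x \<in> {0..1} \<Longrightarrow> 0 < g' x"
    and ends: "f 0 \<le> g 0" "g 1 \<le> f 1"
    and slower: "\<And>x y. x \<in> {0..1} \<Longrightarrow> y \<in> {0..1} \<Longrightarrow> f x = g y \<Longrightarrow> f' x \<le> g' y"
    and x: "x \<in> {0..1}"
  shows "f x = g x"
proof -
  have cont: "continuous_on {0..1} f" "continuous_on {0..1} g"
    using f g by (meson DERIV_continuous continuous_on_eq_continuous_within)+
  have mono: "h x < h y"
    if "\<And>x. x \<in> {0..1} \<Longrightarrow> (h has_real_derivative h' x) (at x within {0..1})"
      "\<And>x. x \<in> {0..1} \<Longrightarrow> 0 < h' x" "0 \<le> x" "x < y" "y \<le> 1"
    for h h' :: "real \<Rightarrow> real" and x y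
  proof (rule DERIV_pos_imp_increasing_open[OF that(4)])
    show "continuous_on {x..y} h"
      by (rule continuous_on_subset[of "{0..1}"])
        (use that in \<open>auto simp: continuous_on_eq_continuous_within intro!: DERIV_continuous[OF that(1)]\<close>)
  next
    fix z assume "x < z" "z < y"
    then show "\<exists>D. (h has_real_derivative D) (at z) \<and> 0 < D"
      using that(1,2)[of z] that(3-5) by (auto simp: at_within_Icc_at)
  qed
  note f_mono = mono[OF f f'_pos] and g_mono = mono[OF g g'_pos]
  have inj: "inj_on f {0..1}"
    by (rule inj_onI) (metis atLeastAtMost_iff f_mono linorder_neqE order_less_irrefl)
  have surj: "{f 0..f 1} \<subseteq> f ` {0..1}"
  proof
    fix t assume "t \<in> {f 0..f 1}"
    then obtain x where "0 \<le> x" "x \<le> 1" "f x = t"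
      using IVT'[of f 0 t 1] cont(1) by auto
    then show "t \<in> f ` {0..1}" by auto
  qed
  have f_range: "f x \<in> {f 0..f 1}" if "x \<in> {0..1}" for x
    using f_mono[of 0 x] f_mono[of x 1] that
    by (cases "x = 0"; cases "x = 1") (auto intro: less_imp_le)
  have image: "f ` {0..1} = {f 0..f 1}"
    using surj image_subsetI[of "{0..1}" f, OF f_range] by (rule equalityI[rotated])
  define i where "i = the_inv_into {0..1} f"
  have i_f: "i (f x) = x" if "x \<in> {0..1}" for x
    unfolding i_def using the_inv_into_f_f[OF inj that] .
  have f_i: "f (i t) = t" "i t \<in> {0..1}" if "t \<in> {f 0..f 1}" for t
    using f_the_inv_into_f[OF inj, of t] the_inv_into_into[OF inj, of t "{0..1}"] that
    by (simp_all only: image i_def order_refl)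
  have i_cont: "continuous_on {f 0..f 1} i"
    using continuous_on_inv_into[OF cont(1) compact_Icc inj] by (simp add: i_def image)
  have g_range: "g x \<in> {f 0..f 1}" if "x \<in> {0..1}" for x
    using g_mono[of 0 x] g_mono[of x 1] ends that
    by (cases "x = 0"; cases "x = 1") (auto intro: less_imp_le)
  \<comment> \<open>The displacement \<open>y\<close> is nondecreasing, but it starts at a value
    \<ge> 0 and ends at a value \<le> 0 because \<open>i\<close> maps into [0,1]; so it vanishes
    identically.\<close>
  define y where "y x = i (g x) - x" for x
  have y_cont: "continuous_on {0..1} y"
    unfolding y_def using g_range
    by (intro continuous_intros continuous_on_compose2[OF i_cont cont(2)]) auto
  have y_deriv: "\<exists>D. (y has_real_derivative D) (at x) \<and> 0 \<le> D" if x: "0 < x" "x < 1" for x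
  proof -
    have gx: "f 0 < g x" "g x < f 1"
      using g_mono[of 0 x] g_mono[of x 1] x ends by auto
    then have range: "g x \<in> {f 0..f 1}" by simp
    define z where "z = i (g x)"
    have z: "z \<in> {0..1}" "f z = g x"
      using f_i[OF range] by (auto simp: z_def)
    then have z01: "0 < z" "z < 1"
      using gx by (auto simp: less_le)
    have di: "(i has_real_derivative inverse (f' z)) (at (g x))"
    proof (rule DERIV_inverse_function[of f])
      show "(f has_real_derivative f' z) (at (i (g x)))"
        using f[OF z(1)] z01 by (simp add: z_def at_within_Icc_at)
      show "f' z \<noteq> 0" using f'_pos[OF z(1)] by simp
      show "f 0 < g x" "g x < f 1" by (fact gx)+
      show "f (i t) = t" if "f 0 < t" "t < f 1" for t using f_i that by simp
      show "isCont i (g x)"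
        using continuous_on_interior[OF i_cont] gx by simp
    qed
    have dg: "(g has_real_derivative g' x) (at x)"
      using g[of x] x by (simp add: at_within_Icc_at)
    have "(y has_real_derivative inverse (f' z) * g' x - 1) (at x)"
      unfolding y_def by (intro derivative_intros DERIV_chain2[OF di dg])
    moreover have "f' z \<le> g' x" "0 < f' z"
      using slower[OF z(1) _ z(2)] x f'_pos[OF z(1)] by auto
    ultimately show ?thesis
      by (intro exI conjI) (auto simp: field_simps)
  qed
  have "y x \<ge> y 0"
    by (rule DERIV_nonneg_imp_increasing_open)
      (use x in \<open>auto intro!: y_deriv continuous_on_subset[OF y_cont]\<close>)
  moreover have "y 1 \<ge> y x"
    by (rule DERIV_nonneg_imp_increasing_open)
      (use x in \<open>auto intro!: y_deriv continuous_on_subset[OF y_cont]\<close>)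
  moreover have "y 0 \<ge> 0" "y 1 \<le> 0"
    using f_i(2)[OF g_range, of 0] f_i(2)[OF g_range, of 1] by (auto simp: y_def)
  ultimately have "i (g x) = x"
    by (simp add: y_def)
  then show ?thesis
    using f_i(1)[OF g_range[OF x]] by simp
qed

section \<open>The level at an end and its difference quotient\<close>

text \<open>
  By the boundary condition and the first integral of the Euler--Lagrange equation, a solution
  takes the same \<open>level\<close> at both ends; \<open>chord\<close> comes from its difference quotient
  (\<open>level_diff\<close> below).
\<close>

definition level :: "real \<Rightarrow> real \<Rightarrow> real \<Rightarrow> real \<Rightarrow> real" where
  "level W E \<kappa> p = W\<^sup>2 * (1 - p\<^sup>2) / (1 - (1 - \<kappa>) * p\<^sup>2) + 1 - p\<^sup>2 + 2 * E * p"

definition chord :: "real \<Rightarrow> real \<Rightarrow> real \<Rightarrow> real \<Rightarrow> real" where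
  "chord W \<kappa> p q = (p + q) * (1 + W\<^sup>2 * \<kappa> / ((1 - (1 - \<kappa>) * p\<^sup>2) * (1 - (1 - \<kappa>) * q\<^sup>2)))"

lemma elastic_eq: "elastic \<kappa> t = 1 - (1 - \<kappa>) * (cos t)\<^sup>2"
  unfolding elastic_def sin_squared_eq by (simp add: algebra_simps)

lemma level_denom_ge:
  fixes \<kappa> p :: real
  assumes "\<kappa> < 1" "- 1 < p" "p < 1"
  shows "\<kappa> \<le> 1 - (1 - \<kappa>) * p\<^sup>2"
proof -
  have "p\<^sup>2 \<le> 1" using assms by (intro abs_square_le_1[THEN iffD2]) auto
  then have "(1 - \<kappa>) * p\<^sup>2 \<le> (1 - \<kappa>) * 1"
    using assms by (intro mult_left_mono) auto
  then show ?thesis by simp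
qed

lemma level_diff:
  assumes \<kappa>: "0 < \<kappa>" "\<kappa> < 1" and p: "- 1 < p" "p < 1" and q: "- 1 < q" "q < 1"
  shows "level W E \<kappa> p - level W E \<kappa> q = (p - q) * (2 * E - chord W \<kappa> p q)"
proof -
  define a where "a = 1 - (1 - \<kappa>) * p\<^sup>2"
  define b where "b = 1 - (1 - \<kappa>) * q\<^sup>2"
  define t where "t = W\<^sup>2 * \<kappa> / (a * b)"
  have ab: "a \<noteq> 0" "b \<noteq> 0"
    using level_denom_ge[OF \<kappa>(2) p] level_denom_ge[OF \<kappa>(2) q] \<kappa> by (auto simp: a_def b_def)
  \<comment> \<open>The terms in \<open>p\<^sup>2 * q\<^sup>2\<close> cancel, so
    \<open>p - q\<close> factors out of the difference of the two fractions.\<close>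
  have "(1 - p\<^sup>2) * b - (1 - q\<^sup>2) * a = - (\<kappa> * (p - q) * (p + q))"
    by (simp add: a_def b_def power2_eq_square algebra_simps)
  then have "(1 - p\<^sup>2) / a - (1 - q\<^sup>2) / b = - (\<kappa> * (p - q) * (p + q)) / (a * b)"
    using ab by (simp add: field_simps)
  then have "W\<^sup>2 * (1 - p\<^sup>2) / a - W\<^sup>2 * (1 - q\<^sup>2) / b = W\<^sup>2 * (- (\<kappa> * (p - q) * (p + q)) / (a * b))"
    by (metis right_diff_distrib times_divide_eq_right)
  also have "W\<^sup>2 * (- (\<kappa> * (p - q) * (p + q)) / (a * b)) = - ((p - q) * (p + q) * t)"
    unfolding t_def by (simp add: ac_simps)
  finally have "W\<^sup>2 * (1 - p\<^sup>2) / a - W\<^sup>2 * (1 - q\<^sup>2) / b = - ((p - q) * (p + q) * t)" .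
  moreover have "level W E \<kappa> p - level W E \<kappa> q =
      (W\<^sup>2 * (1 - p\<^sup>2) / a - W\<^sup>2 * (1 - q\<^sup>2) / b) - (p\<^sup>2 - q\<^sup>2) + 2 * E * (p - q)"
    unfolding level_def a_def[symmetric] b_def[symmetric] right_diff_distrib[of "2 * E"] by linarith
  ultimately have "level W E \<kappa> p - level W E \<kappa> q =
      - ((p - q) * (p + q) * t) - (p\<^sup>2 - q\<^sup>2) + 2 * E * (p - q)"
    by (simp only:)
  also have "\<dots> = (p - q) * (2 * E - (p + q) * (1 + t))"
    by (simp add: power2_eq_square algebra_simps)
  finally show ?thesis
    unfolding chord_def t_def a_def b_def .
qed

lemma chord_commute: "chord W \<kappa> p q = chord W \<kappa> q p"
  by (simp add: chord_def add.commute mult.commute)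

text \<open>Not monotone factor by factor: for negative \<open>p\<close> the denominator grows with
  \<open>p\<close> while \<open>p + q\<close> grows too. Cross-multiplying
  \<open>(p + q) / a\<close> and removing the factor \<open>p' - p\<close> leaves
  \<open>1 + k * (p * p' + q * p' + q * p)\<close>, whose sign decides.\<close>

lemma chord_strict_mono:
  assumes \<kappa>: "0 < \<kappa>" "\<kappa> < 1" and p: "- 1 < p" "p < p'" "p' < 1" and q: "- 1 < q" "q < 1"
  shows "chord W \<kappa> p q < chord W \<kappa> p' q"
proof -
  define k where "k = 1 - \<kappa>"
  define a where "a = 1 - k * p\<^sup>2"
  define a' where "a' = 1 - k * p'\<^sup>2"
  define b where "b = 1 - k * q\<^sup>2"
  have pos: "0 < a" "0 < a'" "0 < b"
    using level_denom_ge[of \<kappa> p] level_denom_ge[of \<kappa> p'] level_denom_ge[of \<kappa> q] assms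
    by (auto simp: a_def a'_def b_def k_def)
  \<comment> \<open>The sum of these two products is twice
    \<open>1 + (p * p' + q * p' + q * p)\<close>, the odd terms cancelling.\<close>
  have "0 < (1 + p) * (1 + p') * (1 + q)" "0 < (1 - p) * (1 - p') * (1 - q)"
    using p q by (intro mult_pos_pos; linarith)+
  then have "- 1 < p * p' + q * p' + q * p"
    by (simp add: algebra_simps)
  then have "k * (- 1) < k * (p * p' + q * p' + q * p)"
    using \<kappa> by (intro mult_strict_left_mono) (auto simp: k_def)
  then have "0 < 1 + k * (p * p' + q * p' + q * p)"
    using \<kappa> by (simp add: k_def)
  then have "0 < (p' - p) * (1 + k * (p * p' + q * p' + q * p))"
    using p by simp
  then have "(p + q) * a' < (p' + q) * a"
    by (simp add: a_def a'_def power2_eq_square algebra_simps)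
  then have "(p + q) / a < (p' + q) / a'"
    using pos by (simp add: field_simps)
  then have "W\<^sup>2 * \<kappa> / b * ((p + q) / a) \<le> W\<^sup>2 * \<kappa> / b * ((p' + q) / a')"
    using pos \<kappa> by (intro mult_left_mono) auto
  then have "(p + q) + W\<^sup>2 * \<kappa> / b * ((p + q) / a) < (p' + q) + W\<^sup>2 * \<kappa> / b * ((p' + q) / a')"
    using p by simp
  then show ?thesis
    by (simp add: chord_def k_def[symmetric] a_def[symmetric] a'_def[symmetric] b_def[symmetric]
        algebra_simps)
qed

lemma chord_mono:
  assumes "0 < \<kappa>" "\<kappa> < 1" "- 1 < p" "p \<le> p'" "p' < 1" "- 1 < q" "q \<le> q'" "q' < 1"
  shows "chord W \<kappa> p q \<le> chord W \<kappa> p' q'"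
proof -
  have "chord W \<kappa> p q \<le> chord W \<kappa> p' q"
    using chord_strict_mono[of \<kappa> p p' q W] assms by (cases "p = p'") auto
  also have "\<dots> \<le> chord W \<kappa> p' q'"
    using chord_strict_mono[of \<kappa> q q' p' W] assms
    by (cases "q = q'") (auto simp: chord_commute[of _ _ p'])
  finally show ?thesis .
qed

section \<open>A single nonconstant solution: first integral, monotonicity, end values\<close>

locale nonconstant_profile =
  fixes W E l \<kappa> :: real and \<theta> :: "real \<Rightarrow> real"
  assumes W_pos: "0 < W" and l_pos: "0 < l" and \<kappa>_pos: "0 < \<kappa>" and \<kappa>_less: "\<kappa> < 1"
    and solution: "nonconst_solution W E l \<kappa> \<theta>"
begin

abbreviation \<theta>' :: "real \<Rightarrow> real" where "\<theta>' \<equiv> deriv01 \<theta>"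
abbreviation \<theta>'' :: "real \<Rightarrow> real" where "\<theta>'' \<equiv> deriv01 \<theta>'"

lemma smooth: "smooth01 \<theta>"
  and range: "x \<in> {0..1} \<Longrightarrow> 0 \<le> \<theta> x \<and> \<theta> x \<le> pi"
  and ode: "0 < x \<Longrightarrow> x < 1 \<Longrightarrow> euler_lagrange E l \<kappa> \<theta> x"
  and bc: "boundary_cond W l \<kappa> \<theta> 0" "boundary_cond W l \<kappa> \<theta> 1"
  using solution by (auto simp: nonconst_solution_def bvp_solution_def image_subset_iff)

lemma nonconst: "\<not> (\<forall>x\<in>{0..1}. \<theta> x = c)"
  using solution by (auto simp: nonconst_solution_def constant_on_def)

lemma deriv01_works:
  "f differentiable_on {0..1} \<Longrightarrow> x \<in> {0..1} \<Longrightarrow>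
    (f has_real_derivative deriv01 f x) (at x within {0..1})"
  by (simp add: differentiable_on_def vector_derivative_works deriv01_def
      has_real_derivative_iff_has_vector_derivative)

lemma D1: "x \<in> {0..1} \<Longrightarrow> (\<theta> has_real_derivative \<theta>' x) (at x within {0..1})"
  using smooth[unfolded smooth01_def, rule_format, of 0] deriv01_works by simp

lemma D2: "x \<in> {0..1} \<Longrightarrow> (\<theta>' has_real_derivative \<theta>'' x) (at x within {0..1})"
  using smooth[unfolded smooth01_def, rule_format, of 1] deriv01_works by simp

lemma D1_at: "0 < x \<Longrightarrow> x < 1 \<Longrightarrow> (\<theta> has_real_derivative \<theta>' x) (at x)"
  using D1[of x] by (simp add: at_within_Icc_at)

lemma D2_at: "0 < x \<Longrightarrow> x < 1 \<Longrightarrow> (\<theta>' has_real_derivative \<theta>'' x) (at x)"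
  using D2[of x] by (simp add: at_within_Icc_at)

lemma cont: "continuous_on {0..1} \<theta>" "continuous_on {0..1} \<theta>'"
  using D1 D2 by (meson DERIV_continuous continuous_on_eq_continuous_within)+

lemma elastic_ge: "\<kappa> \<le> elastic \<kappa> t"
proof -
  have "elastic \<kappa> t - \<kappa> = (1 - \<kappa>) * (sin t)\<^sup>2"
    unfolding elastic_def cos_squared_eq by (simp add: algebra_simps)
  also have "\<dots> \<ge> 0" using \<kappa>_less by simp
  finally show ?thesis by simp
qed

lemma elastic_pos: "0 < elastic \<kappa> t"
  using elastic_ge[of t] \<kappa>_pos by simp

text \<open>The derivative of this energy is \<open>2 * \<theta>' x\<close> times the Euler-Lagrange
  expression; continuity carries the constant to the two endpoints.\<close>

lemma first_integral:
  assumes "x \<in> {0..1}" "y \<in> {0..1}"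
  shows "elastic \<kappa> (\<theta> x) * (\<theta>' x)\<^sup>2 + l\<^sup>2 * ((sin (\<theta> x))\<^sup>2 + 2 * E * cos (\<theta> x)) =
         elastic \<kappa> (\<theta> y) * (\<theta>' y)\<^sup>2 + l\<^sup>2 * ((sin (\<theta> y))\<^sup>2 + 2 * E * cos (\<theta> y))"
proof -
  define H where
    "H x = elastic \<kappa> (\<theta> x) * (\<theta>' x)\<^sup>2 + l\<^sup>2 * ((sin (\<theta> x))\<^sup>2 + 2 * E * cos (\<theta> x))" for x
  have "continuous_on {0..1} H"
    unfolding H_def elastic_def by (intro continuous_intros cont)
  moreover have "(H has_real_derivative 0) (at x)" if "0 < x" "x < 1" for x
  proof -
    have "(H has_real_derivative 2 * \<theta>' x * (elastic \<kappa> (\<theta> x) * \<theta>'' x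
        + 1/2 * (1 - \<kappa>) * sin (2 * \<theta> x) * (\<theta>' x)\<^sup>2
        + 1/2 * l\<^sup>2 * sin (2 * \<theta> x) - E * l\<^sup>2 * sin (\<theta> x))) (at x)"
      unfolding H_def elastic_def sin_double using that
      by (auto intro!: derivative_eq_intros D1_at D2_at
          simp: field_simps power2_eq_square)
    then show ?thesis
      using ode[OF that] by (simp add: euler_lagrange_def)
  qed
  ultimately have "H x = H 0" "H y = H 0"
    using assms by (auto intro!: DERIV_isconst2[of 0 1])
  then show ?thesis by (simp add: H_def)
qed

text \<open>This plays the role of uniqueness for the initial value problem. The expression is half
  the derivative of the potential \<open>(sin t)\<^sup>2 + 2 * E * cos t\<close> at
  \<open>\<theta> a\<close>. If it vanished, the potential would differ from its value there by at
  most a quadratic term, the first integral would bound \<open>(\<theta>' x)\<^sup>2\<close> by a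
  multiple of \<open>(\<theta> x - \<theta> a)\<^sup>2\<close>, and Gronwall would make \<theta>
  constant.\<close>

lemma no_equilibrium:
  assumes a: "a \<in> {0..1}" "\<theta>' a = 0"
  shows "sin (\<theta> a) * (cos (\<theta> a) - E) \<noteq> 0"
proof
  assume eq: "sin (\<theta> a) * (cos (\<theta> a) - E) = 0"
  define M where "M = 2 * \<bar>E\<bar> + 2"
  have M: "1 \<le> M" by (simp add: M_def)
  have cos_diff: "\<bar>cos t - cos (\<theta> a)\<bar> \<le> \<bar>t - \<theta> a\<bar>" for t
  proof -
    have "\<bar>cos t - cos (\<theta> a)\<bar> = 2 * \<bar>sin ((t + \<theta> a) / 2)\<bar> * \<bar>sin ((\<theta> a - t) / 2)\<bar>"
      by (simp add: cos_diff_cos abs_mult)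
    also have "\<dots> \<le> 2 * 1 * \<bar>(\<theta> a - t) / 2\<bar>"
      by (intro mult_mono abs_sin_x_le_abs_x) auto
    finally show ?thesis by simp
  qed
  have U: "\<bar>((sin (\<theta> a))\<^sup>2 + 2 * E * cos (\<theta> a)) - ((sin t)\<^sup>2 + 2 * E * cos t)\<bar>
      \<le> M * (t - \<theta> a)\<^sup>2" for t
  proof -
    have *: "((sin (\<theta> a))\<^sup>2 + 2 * E * cos (\<theta> a)) - ((sin t)\<^sup>2 + 2 * E * cos t) =
        (cos t - cos (\<theta> a)) * (cos t + cos (\<theta> a) - 2 * E)"
      unfolding sin_squared_eq by (simp add: power2_eq_square algebra_simps)
    show ?thesis
    \<comment> \<open>If \<open>cos (\<theta> a) = E\<close>, both factors equal
      \<open>cos t - cos (\<theta> a)\<close> and each is linearly small. Otherwise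
      \<open>sin (\<theta> a) = 0\<close>, the first factor alone is quadratically small, and
      \<open>M\<close> bounds the second.\<close>
    proof (cases "cos (\<theta> a) = E")
      case True
      have "\<bar>(cos t - cos (\<theta> a)) * (cos t + cos (\<theta> a) - 2 * E)\<bar> = \<bar>cos t - cos (\<theta> a)\<bar>\<^sup>2"
        by (simp add: True[symmetric] abs_mult power2_eq_square)
      also have "\<dots> \<le> \<bar>t - \<theta> a\<bar>\<^sup>2"
        by (intro power_mono cos_diff) auto
      also have "\<dots> \<le> M * (t - \<theta> a)\<^sup>2"
        using M by (simp add: mult_le_cancel_right1)
      finally show ?thesis unfolding * .
    next
      case False
      with eq have "sin (\<theta> a) = 0" by simp
      then have s: "\<bar>cos (\<theta> a)\<bar> = 1"
        using sin_cos_squared_add[of "\<theta> a"] by (simp add: abs_square_eq_1)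
      have "cos t = cos (\<theta> a) * cos (t - \<theta> a)"
        using \<open>sin (\<theta> a) = 0\<close> cos_add[of "\<theta> a" "t - \<theta> a"] by simp
      then have "\<bar>cos t - cos (\<theta> a)\<bar> = \<bar>cos (\<theta> a) * (cos (t - \<theta> a) - 1)\<bar>"
        by (simp add: algebra_simps)
      also have "\<dots> = \<bar>1 - cos (t - \<theta> a)\<bar>"
        by (simp add: abs_mult s abs_minus_commute)
      also have "\<dots> = 2 * \<bar>sin ((t - \<theta> a) / 2)\<bar>\<^sup>2"
        using cos_double_sin[of "(t - \<theta> a) / 2"] by (simp add: diff_divide_distrib)
      also have "\<dots> \<le> 2 * \<bar>(t - \<theta> a) / 2\<bar>\<^sup>2"
        by (intro mult_left_mono power_mono abs_sin_x_le_abs_x) auto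
      also have "\<dots> \<le> (t - \<theta> a)\<^sup>2"
        by (simp add: power_divide)
      finally have 1: "\<bar>cos t - cos (\<theta> a)\<bar> \<le> (t - \<theta> a)\<^sup>2" .
      have "\<bar>cos t + cos (\<theta> a) - 2 * E\<bar> \<le> M"
        using abs_cos_le_one[of t] s unfolding M_def by linarith
      then show ?thesis
        unfolding * abs_mult using mult_mono[OF 1, of "\<bar>cos t + cos (\<theta> a) - 2 * E\<bar>" M]
        by (simp add: mult.commute)
    qed
  qed
  define K where "K = l\<^sup>2 * M / \<kappa>"
  have d2: "(\<theta>' x)\<^sup>2 \<le> K * (\<theta> x - \<theta> a)\<^sup>2" if x: "x \<in> {0..1}" for x
  proof -
    have "\<kappa> * (\<theta>' x)\<^sup>2 \<le> elastic \<kappa> (\<theta> x) * (\<theta>' x)\<^sup>2"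
      by (intro mult_right_mono elastic_ge) auto
    also have "\<dots> = l\<^sup>2 * (((sin (\<theta> a))\<^sup>2 + 2 * E * cos (\<theta> a)) -
        ((sin (\<theta> x))\<^sup>2 + 2 * E * cos (\<theta> x)))"
      using first_integral[OF x a(1)] a(2) by (simp add: algebra_simps)
    also have "\<dots> \<le> l\<^sup>2 * (M * (\<theta> x - \<theta> a)\<^sup>2)"
      by (intro mult_left_mono order_trans[OF abs_ge_self U]) auto
    finally show ?thesis
      using \<kappa>_pos by (simp add: K_def field_simps)
  qed
  have "(\<theta> x - \<theta> a)\<^sup>2 = 0" if x: "x \<in> {0..1}" for x
  proof (rule zero_of_derivative_bound[where v = "\<lambda>x. (\<theta> x - \<theta> a)\<^sup>2" and v' = "\<lambda>x. 2 * (\<theta> x - \<theta> a) * \<theta>' x"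
        and L = "1 + K" and a = a])
    fix x :: real assume x: "x \<in> {0..1}"
    show "((\<lambda>x. (\<theta> x - \<theta> a)\<^sup>2) has_real_derivative 2 * (\<theta> x - \<theta> a) * \<theta>' x)
        (at x within {0..1})"
      using x by (auto intro!: derivative_eq_intros D1)
    have "\<bar>2 * (\<theta> x - \<theta> a) * \<theta>' x\<bar> \<le> (\<theta> x - \<theta> a)\<^sup>2 + (\<theta>' x)\<^sup>2"
      using sum_squares_bound[of "\<bar>\<theta> x - \<theta> a\<bar>" "\<bar>\<theta>' x\<bar>"]
      by (simp only: abs_mult abs_numeral power2_abs)
    with d2[OF x] show "\<bar>2 * (\<theta> x - \<theta> a) * \<theta>' x\<bar> \<le> (1 + K) * (\<theta> x - \<theta> a)\<^sup>2"
      by (simp add: algebra_simps)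
  qed (use a x in auto)
  then show False
    using nonconst[of "\<theta> a"] by auto
qed

lemma ode_at_critical:
  assumes "0 < x" "x < 1" "\<theta>' x = 0"
  shows "elastic \<kappa> (\<theta> x) * \<theta>'' x = - (l\<^sup>2 * (sin (\<theta> x) * (cos (\<theta> x) - E)))"
  using ode[OF assms(1,2), unfolded euler_lagrange_def sin_double] assms(3)
  by (simp add: algebra_simps)

lemma bc': "x \<in> {0, 1} \<Longrightarrow> elastic \<kappa> (\<theta> x) * \<theta>' x = W * l * sin (\<theta> x)"
  using bc by (auto simp: boundary_cond_def)

text \<open>If the sine vanished at an end, the boundary condition would make the slope vanish too,
  giving a critical point at an equilibrium.\<close>

lemma ends_pos:
  assumes x: "x \<in> {0, 1}"
  shows "0 < sin (\<theta> x)" "0 < \<theta>' x"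
proof -
  have r: "x \<in> {0..1}" using x by auto
  have "sin (\<theta> x) \<noteq> 0"
    using no_equilibrium[OF r] bc'[OF x] elastic_pos[of "\<theta> x"] by auto
  moreover have "0 \<le> sin (\<theta> x)"
    using range[OF r] sin_ge_zero by blast
  ultimately show s: "0 < sin (\<theta> x)" by simp
  have "0 < elastic \<kappa> (\<theta> x) * \<theta>' x"
    unfolding bc'[OF x] using s W_pos l_pos by simp
  then show "0 < \<theta>' x"
    using elastic_pos[of "\<theta> x"] by (simp add: zero_less_mult_iff)
qed

text \<open>Where the slope vanishes, the equation gives \<theta>'' the sign of
  \<open>E - cos (\<theta> x)\<close>. This separates the angles possible at an interior maximum
  from those possible at an interior minimum.\<close>

lemma critical_sign:
  assumes x: "0 < x" "x < 1" and crit: "\<theta>' x = 0"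
  shows "\<theta>'' x \<noteq> 0" "\<theta>'' x \<le> 0 \<Longrightarrow> E < cos (\<theta> x)" "0 \<le> \<theta>'' x \<Longrightarrow> cos (\<theta> x) < E"
proof -
  have r: "x \<in> {0..1}" using x by auto
  have ne: "sin (\<theta> x) * (cos (\<theta> x) - E) \<noteq> 0"
    using no_equilibrium[OF r crit] .
  have s: "0 < sin (\<theta> x)"
    using range[OF r] sin_ge_zero[of "\<theta> x"] ne by (auto simp: less_le)
  note eq = ode_at_critical[OF x crit] and pos = elastic_pos[of "\<theta> x"]
  show "\<theta>'' x \<noteq> 0" using eq ne l_pos by auto
  show "E < cos (\<theta> x)" if "\<theta>'' x \<le> 0"
  proof -
    have "elastic \<kappa> (\<theta> x) * \<theta>'' x \<le> 0"
      using that pos by (simp add: mult_le_0_iff)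
    then show ?thesis
      using eq s ne l_pos by (auto simp: zero_le_mult_iff)
  qed
  show "cos (\<theta> x) < E" if "0 \<le> \<theta>'' x"
  proof -
    have "0 \<le> elastic \<kappa> (\<theta> x) * \<theta>'' x"
      using that pos by simp
    then show ?thesis
      using eq s ne l_pos by (auto simp: mult_le_0_iff)
  qed
qed

lemma \<theta>'_pos:
  assumes x: "x \<in> {0..1}"
  shows "0 < \<theta>' x"
proof (rule ccontr)
  assume "\<not> 0 < \<theta>' x"
  with x ends_pos have x01: "0 < x" "x < 1" by (auto simp: less_le)
  \<comment> \<open>A mere zero of the slope has to be excluded first: if \<theta>' were nonnegative
    in the interior, \<open>x\<close> would minimize it, forcing
    \<open>\<theta>'' x = 0\<close>.\<close>
  have "\<exists>c. 0 < c \<and> c < 1 \<and> \<theta>' c < 0"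
  proof (rule ccontr)
    assume "\<not> ?thesis"
    then have nn: "0 \<le> \<theta>' c" if "0 < c" "c < 1" for c
      using that by (meson not_less)
    with \<open>\<not> 0 < \<theta>' x\<close> x01 have 0: "\<theta>' x = 0" by (meson antisym_conv not_less)
    have "\<theta>'' x = 0"
      by (rule DERIV_local_min[OF D2_at[OF x01], of "min x (1 - x)"])
        (use x01 0 nn in auto)
    with critical_sign(1)[OF x01 0] show False by simp
  qed
  then obtain c where c: "0 < c" "c < 1" "\<theta>' c < 0" by blast
  \<comment> \<open>The maximum on \<open>{0..c}\<close> and the minimum on \<open>{c..1}\<close>
    are both interior: the slope is positive at 0 and 1 and negative at \<open>c\<close>.\<close>
  have "\<exists>a\<in>{0..c}. \<forall>y\<in>{0..c}. \<theta> y \<le> \<theta> a"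
    using c by (intro continuous_attains_sup continuous_on_subset[OF cont(1)]) auto
  then obtain a where a: "a \<in> {0..c}" "\<And>y. y \<in> {0..c} \<Longrightarrow> \<theta> y \<le> \<theta> a" by blast
  have "\<exists>b\<in>{c..1}. \<forall>y\<in>{c..1}. \<theta> b \<le> \<theta> y"
    using c by (intro continuous_attains_inf continuous_on_subset[OF cont(1)]) auto
  then obtain b where b: "b \<in> {c..1}" "\<And>y. y \<in> {c..1} \<Longrightarrow> \<theta> b \<le> \<theta> y" by blast
  have "a \<noteq> 0"
  proof
    assume "a = 0"
    obtain d where "d > 0" and d: "\<And>h. 0 < h \<Longrightarrow> 0 + h \<in> {0..1} \<Longrightarrow> h < d \<Longrightarrow> \<theta> 0 < \<theta> (0 + h)"
      using has_real_derivative_pos_inc_right[OF D1[of 0]] ends_pos[of 0] by auto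
    define h where "h = min (d / 2) (c)"
    have "0 < h" "h < d" "h \<le> c"
      using c \<open>d > 0\<close> by (auto simp: h_def)
    with d[of h] a(2)[of h] c \<open>a = 0\<close> show False by auto
  qed
  moreover have "a \<noteq> c"
  proof
    assume "a = c"
    obtain d where "d > 0" and d: "\<And>h. 0 < h \<Longrightarrow> h < d \<Longrightarrow> \<theta> c < \<theta> (c - h)"
      using DERIV_neg_dec_left[OF D1_at[OF c(1,2)] c(3)] by auto
    define h where "h = min (d / 2) (c)"
    have "0 < h" "h < d" "h \<le> c"
      using c \<open>d > 0\<close> by (auto simp: h_def)
    with d[of h] a(2)[of "c - h"] c \<open>a = c\<close> show False by auto
  qed
  ultimately have a': "0 < a" "a < c" using a by auto
  have "b \<noteq> 1"
  proof
    assume "b = 1"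
    obtain d where "d > 0" and d: "\<And>h. 0 < h \<Longrightarrow> 1 - h \<in> {0..1} \<Longrightarrow> h < d \<Longrightarrow> \<theta> (1 - h) < \<theta> 1"
      using has_real_derivative_pos_inc_left[OF D1[of 1]] ends_pos[of 1] by auto
    define h where "h = min (d / 2) (1 - c)"
    have "0 < h" "h < d" "h \<le> 1 - c"
      using c \<open>d > 0\<close> by (auto simp: h_def)
    with d[of h] b(2)[of "1 - h"] c \<open>b = 1\<close> show False by auto
  qed
  moreover have "b \<noteq> c"
  proof
    assume "b = c"
    obtain d where "d > 0" and d: "\<And>h. 0 < h \<Longrightarrow> h < d \<Longrightarrow> \<theta> (c + h) < \<theta> c"
      using DERIV_neg_dec_right[OF D1_at[OF c(1,2)] c(3)] by auto
    define h where "h = min (d / 2) (1 - c)"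
    have "0 < h" "h < d" "h \<le> 1 - c"
      using c \<open>d > 0\<close> by (auto simp: h_def)
    with d[of h] b(2)[of "c + h"] c \<open>b = c\<close> show False by auto
  qed
  ultimately have b': "c < b" "b < 1" using b by auto
  have a01: "0 < a" "a < 1" and b01: "0 < b" "b < 1" using a' b' c by auto
  have ta: "\<theta>' a = 0" "\<theta>'' a \<le> 0"
    by (rule interior_max_derivatives[of 0 c, OF D1_at D2_at[OF a01]]; use a a' c in auto)+
  have "- \<theta>' b = 0" "- \<theta>'' b \<le> 0"
    by (rule interior_max_derivatives[of c 1 "\<lambda>x. - \<theta> x" "\<lambda>x. - \<theta>' x",
          OF DERIV_minus[OF D1_at] DERIV_minus[OF D2_at[OF b01]]]; use b b' c in auto)+
  then have tb: "\<theta>' b = 0" "0 \<le> \<theta>'' b" by auto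
  have "cos (\<theta> b) < cos (\<theta> a)"
    using critical_sign(2)[OF a01 ta] critical_sign(3)[OF b01 tb] by simp
  moreover have "\<theta> b \<le> \<theta> a"
    \<comment> \<open>The value at \<open>c\<close> lies between the two extrema, since
      \<open>c\<close> belongs to both intervals.\<close>
    using a(2)[of c] b(2)[of c] c by force
  then have "cos (\<theta> a) \<le> cos (\<theta> b)"
    using range[of a] range[of b] a01 b01 by (intro cos_monotone_0_pi_le) auto
  ultimately show False by simp
qed

lemma \<theta>_strict_mono:
  assumes "0 \<le> x" "x < y" "y \<le> 1"
  shows "\<theta> x < \<theta> y"
proof (rule DERIV_pos_imp_increasing_open[OF assms(2)])
  show "\<exists>D. (\<theta> has_real_derivative D) (at z) \<and> 0 < D" if "x < z" "z < y" for z
    using D1_at[of z] \<theta>'_pos[of z] that assms by auto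
  show "continuous_on {x..y} \<theta>"
    using assms by (intro continuous_on_subset[OF cont(1)]) auto
qed

lemma px_strict_antimono: "0 \<le> x \<Longrightarrow> x < y \<Longrightarrow> y \<le> 1 \<Longrightarrow> px \<theta> y < px \<theta> x"
  unfolding px_def using \<theta>_strict_mono[of x y] range[of x] range[of y]
  by (intro cos_monotone_0_pi) auto

lemma px_le_start: "x \<in> {0..1} \<Longrightarrow> px \<theta> x \<le> px \<theta> 0"
  using px_strict_antimono[of 0 x] by (cases "x = 0") auto

lemma px_ends_bounds:
  assumes "x \<in> {0, 1}"
  shows "- 1 < px \<theta> x" "px \<theta> x < 1"
proof -
  have "(px \<theta> x)\<^sup>2 < 1"
    using ends_pos(1)[OF assms] sin_cos_squared_add[of "\<theta> x"] zero_less_power[of "sin (\<theta> x)" 2]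
    unfolding px_def by linarith
  then show "- 1 < px \<theta> x" "px \<theta> x < 1"
    by (auto simp: abs_square_less_1)
qed

text \<open>At an end the boundary condition replaces \<open>elastic * \<theta>'\<^sup>2\<close> by
  \<open>(W * l * sin)\<^sup>2 / elastic\<close>, so the constant of the first integral becomes
  \<open>l\<^sup>2\<close> times the level of that end value.\<close>

lemma speed_eq_at_end:
  assumes x: "x \<in> {0, 1}" and y: "y \<in> {0..1}"
  shows "elastic \<kappa> (\<theta> y) * (\<theta>' y)\<^sup>2 =
    l\<^sup>2 * (level W E \<kappa> (px \<theta> x) - (1 - (px \<theta> y)\<^sup>2 + 2 * E * px \<theta> y))"
proof -
  have "elastic \<kappa> (\<theta> x) * (\<theta>' x)\<^sup>2 = (elastic \<kappa> (\<theta> x) * \<theta>' x)\<^sup>2 / elastic \<kappa> (\<theta> x)"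
    using elastic_pos[of "\<theta> x"] by (simp add: power2_eq_square)
  also have "\<dots> = l\<^sup>2 * (W\<^sup>2 * (1 - (px \<theta> x)\<^sup>2) / (1 - (1 - \<kappa>) * (px \<theta> x)\<^sup>2))"
    unfolding bc'[OF x] by (simp add: elastic_eq power_mult_distrib sin_squared_eq px_def)
  finally have *: "elastic \<kappa> (\<theta> x) * (\<theta>' x)\<^sup>2 = \<dots>" .
  have "x \<in> {0..1}" using x by auto
  from first_integral[OF y this] show ?thesis
    unfolding * by (simp add: sin_squared_eq px_def level_def algebra_simps)
qed

lemmas speed_eq = speed_eq_at_end[of 0, OF insertI1]

lemma speed_excess_pos:
  assumes "x \<in> {0..1}"
  shows "0 < level W E \<kappa> (px \<theta> 0) - (1 - (px \<theta> x)\<^sup>2 + 2 * E * px \<theta> x)"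
proof -
  have "0 < elastic \<kappa> (\<theta> x) * (\<theta>' x)\<^sup>2"
    using elastic_pos[of "\<theta> x"] \<theta>'_pos[OF assms] by simp
  then show ?thesis
    unfolding speed_eq[OF assms] using l_pos by (simp add: zero_less_mult_iff)
qed

text \<open>Both ends express the same speed, so their levels agree; the end values differ, so the
  factor \<open>p - q\<close> in \<open>level_diff\<close> can be divided out.\<close>

lemma chord_ends: "chord W \<kappa> (px \<theta> 0) (px \<theta> 1) = 2 * E"
proof -
  have "level W E \<kappa> (px \<theta> 0) = level W E \<kappa> (px \<theta> 1)"
    using speed_eq_at_end[of 0 0] speed_eq_at_end[of 1 0] l_pos by simp
  then show ?thesis
    using level_diff[of \<kappa> "px \<theta> 0" "px \<theta> 1" W E] px_ends_bounds[of 0] px_ends_bounds[of 1]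
      \<kappa>_pos \<kappa>_less px_strict_antimono[of 0 1] by auto
qed

text \<open>Since \<open>p\<close> exceeds \<open>px \<theta> 1\<close>, the chord from
  \<open>px \<theta> 0\<close> to \<open>p\<close> exceeds the one to \<open>px \<theta> 1\<close>,
  which is \<open>2 * E\<close>; hence the difference quotient of the level is negative. It lets the
  level of one solution be estimated at the higher start of another.\<close>

lemma level_le_start:
  assumes p: "px \<theta> 0 \<le> p" "p < 1"
  shows "level W E \<kappa> p \<le> level W E \<kappa> (px \<theta> 0)"
proof -
  have b: "- 1 < px \<theta> 1" "px \<theta> 1 < px \<theta> 0" "px \<theta> 0 < 1"
    using px_ends_bounds[of 0] px_ends_bounds[of 1] px_strict_antimono[of 0 1] by auto
  have "2 * E < chord W \<kappa> (px \<theta> 0) p"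
    unfolding chord_ends[symmetric] chord_commute[of _ _ "px \<theta> 0"]
    by (rule chord_strict_mono) (use b p \<kappa>_pos \<kappa>_less in auto)
  then have "(p - px \<theta> 0) * (2 * E - chord W \<kappa> p (px \<theta> 0)) \<le> 0"
    using p by (simp add: mult_nonneg_nonpos chord_commute)
  then show ?thesis
    using level_diff[of \<kappa> p "px \<theta> 0" W E] b p \<kappa>_pos \<kappa>_less by simp
qed

end

section \<open>Comparison of two solutions\<close>

text \<open>The second profile covers the smaller range of angles and is nowhere slower at equal
  angle, which \<open>slower_profile_eq\<close> allows only if the two agree. Each conclusion serves
  to contradict a strict inequality: between final values when the field varies, between boundary
  coefficients when the length or the anchoring varies.\<close>

lemma profiles_coincide:
  assumes P1: "nonconstant_profile W1 E1 l1 \<kappa> \<theta>1" and P2: "nonconstant_profile W2 E2 l2 \<kappa> \<theta>2"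
    and ends: "px \<theta>2 0 \<le> px \<theta>1 0" "px \<theta>1 1 \<le> px \<theta>2 1"
    and slower: "\<And>x p. x \<in> {0..1} \<Longrightarrow> p = px \<theta>1 x \<Longrightarrow>
      l1\<^sup>2 * (level W1 E1 \<kappa> (px \<theta>1 0) - (1 - p\<^sup>2 + 2 * E1 * p)) \<le>
      l2\<^sup>2 * (level W2 E2 \<kappa> (px \<theta>2 0) - (1 - p\<^sup>2 + 2 * E2 * p))"
  shows "px \<theta>1 1 = px \<theta>2 1" "W1 * l1 = W2 * l2"
proof -
  interpret P1: nonconstant_profile W1 E1 l1 \<kappa> \<theta>1 by (fact P1)
  interpret P2: nonconstant_profile W2 E2 l2 \<kappa> \<theta>2 by (fact P2)
  have eq: "\<theta>1 x = \<theta>2 x" if x: "x \<in> {0..1}" for x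
  proof (rule slower_profile_eq[OF P1.D1 P2.D1 P1.\<theta>'_pos P2.\<theta>'_pos _ _ _ x])
    show "\<theta>1 0 \<le> \<theta>2 0" "\<theta>2 1 \<le> \<theta>1 1"
      using ends P1.range[of 0] P1.range[of 1] P2.range[of 0] P2.range[of 1]
      by (auto simp: px_def cos_mono_le_eq)
    fix x y :: real assume xy: "x \<in> {0..1}" "y \<in> {0..1}" and eq: "\<theta>1 x = \<theta>2 y"
    then have "elastic \<kappa> (\<theta>2 y) * (deriv01 \<theta>1 x)\<^sup>2 \<le> elastic \<kappa> (\<theta>2 y) * (deriv01 \<theta>2 y)\<^sup>2"
      using P1.speed_eq[of x] P2.speed_eq[of y] slower[of x "px \<theta>1 x"]
      by (simp add: px_def)
    then have "(deriv01 \<theta>1 x)\<^sup>2 \<le> (deriv01 \<theta>2 y)\<^sup>2"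
      using P1.elastic_pos[of "\<theta>2 y"] by simp
    then show "deriv01 \<theta>1 x \<le> deriv01 \<theta>2 y"
      using P2.\<theta>'_pos[OF xy(2)] by (simp add: power2_le_iff_abs_le)
  qed simp_all
  then show "px \<theta>1 1 = px \<theta>2 1" by (simp add: px_def)
  \<comment> \<open>\<open>deriv01\<close> sees only values on [0,1], so the one-sided slopes at 0
    agree as well; the boundary condition then compares \<open>W1 * l1\<close> with
    \<open>W2 * l2\<close>.\<close>
  have "(\<theta>2 has_real_derivative deriv01 \<theta>1 0) (at 0 within {0..1})"
    by (rule has_field_derivative_transform_within[OF P1.D1[of 0] zero_less_one]) (auto simp: eq)
  then have d: "deriv01 \<theta>1 0 = deriv01 \<theta>2 0"
    using P2.D1[of 0] vector_derivative_unique_within[of "0::real" "{0..1}" \<theta>2]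
    by (auto simp: has_real_derivative_iff_has_vector_derivative trivial_limit_within islimpt_Icc)
  have start: "\<theta>1 0 = \<theta>2 0" by (rule eq) simp
  have "W1 * l1 * sin (\<theta>2 0) = W2 * l2 * sin (\<theta>2 0)"
    by (rule P1.bc'[OF insertI1, unfolded d start, unfolded P2.bc'[OF insertI1], symmetric])
  then show "W1 * l1 = W2 * l2"
    using P2.ends_pos(1)[OF insertI1] by (metis mult_right_cancel less_irrefl)
qed

lemma px_ends_strict_mono_length:
  assumes P1: "nonconstant_profile W E l1 \<kappa> \<theta>1" and P2: "nonconstant_profile W E l2 \<kappa> \<theta>2"
    and less: "l1 < l2"
  shows "px \<theta>1 0 < px \<theta>2 0" "px \<theta>2 1 < px \<theta>1 1"
proof -
  interpret P1: nonconstant_profile W E l1 \<kappa> \<theta>1 by (fact P1)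
  interpret P2: nonconstant_profile W E l2 \<kappa> \<theta>2 by (fact P2)
  note b = P1.px_ends_bounds[of 0] P1.px_ends_bounds[of 1] P2.px_ends_bounds[of 0]
    P2.px_ends_bounds[of 1] P1.\<kappa>_pos P1.\<kappa>_less
  have chord_eq: "chord W \<kappa> (px \<theta>1 0) (px \<theta>1 1) = chord W \<kappa> (px \<theta>2 0) (px \<theta>2 1)"
    using P1.chord_ends P2.chord_ends by simp
  show start: "px \<theta>1 0 < px \<theta>2 0"
  proof (rule ccontr)
    assume "\<not> ?thesis"
    then have le: "px \<theta>2 0 \<le> px \<theta>1 0" by simp
    have "W * l1 = W * l2"
    proof (rule profiles_coincide(2)[OF P1 P2 le])
      show "px \<theta>1 1 \<le> px \<theta>2 1"
      proof (rule ccontr)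
        assume "\<not> ?thesis"
        then have less: "px \<theta>2 1 < px \<theta>1 1" by simp
        have "chord W \<kappa> (px \<theta>2 0) (px \<theta>2 1) \<le> chord W \<kappa> (px \<theta>1 0) (px \<theta>2 1)"
          using le b by (intro chord_mono) auto
        also have "\<dots> < chord W \<kappa> (px \<theta>1 0) (px \<theta>1 1)"
          unfolding chord_commute[of _ _ "px \<theta>1 0"] using less b
          by (intro chord_strict_mono) auto
        finally show False using chord_eq by simp
      qed
      fix x p :: real assume x: "x \<in> {0..1}" "p = px \<theta>1 x"
      show "l1\<^sup>2 * (level W E \<kappa> (px \<theta>1 0) - (1 - p\<^sup>2 + 2 * E * p)) \<le>
            l2\<^sup>2 * (level W E \<kappa> (px \<theta>2 0) - (1 - p\<^sup>2 + 2 * E * p))"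
        \<comment> \<open>Replacing \<open>l1\<^sup>2\<close> by the larger
          \<open>l2\<^sup>2\<close> is legitimate only because the first excess is positive.\<close>
        using P1.speed_excess_pos[OF x(1)] P2.level_le_start[OF le] b less P1.l_pos
        by (intro mult_mono power_mono) (auto simp: x(2))
    qed
    then show False using less P1.W_pos by simp
  qed
  show "px \<theta>2 1 < px \<theta>1 1"
  proof (rule ccontr)
    assume "\<not> ?thesis"
    then have "chord W \<kappa> (px \<theta>1 0) (px \<theta>1 1) \<le> chord W \<kappa> (px \<theta>1 0) (px \<theta>2 1)"
      using b by (intro chord_mono) auto
    also have "\<dots> < chord W \<kappa> (px \<theta>2 0) (px \<theta>2 1)"
      using start b by (intro chord_strict_mono) auto
    finally show False using chord_eq by simp
  qed
qed

text \<open>The coefficient \<open>W * l\<close> is shared, so the boundary slopes yield no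
  contradiction; the final values do. The chord must grow with the field, so without a higher start
  the end must be strictly higher.\<close>

lemma px_start_strict_mono_field:
  assumes P1: "nonconstant_profile W E1 l \<kappa> \<theta>1" and P2: "nonconstant_profile W E2 l \<kappa> \<theta>2"
    and less: "E1 < E2"
  shows "px \<theta>1 0 < px \<theta>2 0"
proof (rule ccontr)
  interpret P1: nonconstant_profile W E1 l \<kappa> \<theta>1 by (fact P1)
  interpret P2: nonconstant_profile W E2 l \<kappa> \<theta>2 by (fact P2)
  note b = P1.px_ends_bounds[of 0] P1.px_ends_bounds[of 1] P2.px_ends_bounds[of 0]
    P2.px_ends_bounds[of 1] P1.\<kappa>_pos P1.\<kappa>_less
  assume "\<not> ?thesis"
  then have le: "px \<theta>2 0 \<le> px \<theta>1 0" by simp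
  have end_less: "px \<theta>1 1 < px \<theta>2 1"
  proof (rule ccontr)
    assume "\<not> ?thesis"
    then have "chord W \<kappa> (px \<theta>2 0) (px \<theta>2 1) \<le> chord W \<kappa> (px \<theta>1 0) (px \<theta>1 1)"
      using le b by (intro chord_mono) auto
    then show False using P1.chord_ends P2.chord_ends less by simp
  qed
  have "px \<theta>1 1 = px \<theta>2 1"
  proof (rule profiles_coincide(1)[OF P1 P2 le])
    show "px \<theta>1 1 \<le> px \<theta>2 1" using end_less by simp
    fix x p :: real assume x: "x \<in> {0..1}" "p = px \<theta>1 x"
    \<comment> \<open>The field enters the speed only through
      \<open>2 * E * (px \<theta>1 0 - p)\<close>, and the start is the largest value of
      \<open>px\<close> along the profile.\<close>
    have "0 \<le> (E2 - E1) * (px \<theta>1 0 - p)"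
      using less P1.px_le_start[OF x(1)] x by simp
    then have "level W E1 \<kappa> (px \<theta>1 0) - 2 * E1 * p \<le> level W E2 \<kappa> (px \<theta>1 0) - 2 * E2 * p"
      by (simp add: level_def algebra_simps)
    also have "\<dots> \<le> level W E2 \<kappa> (px \<theta>2 0) - 2 * E2 * p"
      using P2.level_le_start[OF le] b by simp
    finally show "l\<^sup>2 * (level W E1 \<kappa> (px \<theta>1 0) - (1 - p\<^sup>2 + 2 * E1 * p)) \<le>
        l\<^sup>2 * (level W E2 \<kappa> (px \<theta>2 0) - (1 - p\<^sup>2 + 2 * E2 * p))"
      by (intro mult_left_mono) auto
  qed
  with end_less show False by simp
qed

section \<open>Large and zero bias fields\<close>

text \<open>In \<open>chord = 2 * E\<close> the sum of the end values is below 2 and each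
  denominator is at least \<kappa>, so the second factor is at most
  \<open>1 + W\<^sup>2 / \<kappa>\<close>. This excludes nonconstant solutions in a strong
  field.\<close>

lemma (in nonconstant_profile) field_bound: "E < 1 + W\<^sup>2 / \<kappa>"
proof -
  note b = px_ends_bounds[of 0] px_ends_bounds[of 1] \<kappa>_pos \<kappa>_less
  define a where "a = (1 - (1 - \<kappa>) * (px \<theta> 0)\<^sup>2) * (1 - (1 - \<kappa>) * (px \<theta> 1)\<^sup>2)"
  have a: "\<kappa> * \<kappa> \<le> a"
    unfolding a_def using b
    by (intro mult_mono level_denom_ge order_trans[OF less_imp_le[OF \<kappa>_pos] level_denom_ge]) auto
  have \<kappa>2: "0 < \<kappa> * \<kappa>" using \<kappa>_pos by simp
  have a_pos: "0 < a" using less_le_trans[OF \<kappa>2 a] .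
  have "W\<^sup>2 * \<kappa> / a \<le> W\<^sup>2 * \<kappa> / (\<kappa> * \<kappa>)"
    by (rule divide_left_mono[OF a _ mult_pos_pos[OF a_pos \<kappa>2]]) (use \<kappa>_pos in simp)
  also have "\<dots> = W\<^sup>2 / \<kappa>"
    using \<kappa>_pos by simp
  finally have le: "W\<^sup>2 * \<kappa> / a \<le> W\<^sup>2 / \<kappa>" .
  define c where "c = 1 + W\<^sup>2 * \<kappa> / a"
  have "0 < c"
    unfolding c_def using a_pos \<kappa>_pos by (intro add_pos_nonneg) auto
  then have "(px \<theta> 0 + px \<theta> 1) * c < 2 * c"
    using b by (intro mult_strict_right_mono) auto
  moreover have "(px \<theta> 0 + px \<theta> 1) * c = 2 * E"
    using chord_ends by (simp add: chord_def c_def a_def)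
  ultimately have "E < c" by simp
  with le show ?thesis by (simp add: c_def)
qed

locale unbiased_profile = nonconstant_profile W 0 l \<kappa> \<theta> for W l \<kappa> \<theta>
begin

lemma px_end: "px \<theta> 1 = - px \<theta> 0"
proof -
  note b = px_ends_bounds[of 0] px_ends_bounds[of 1] \<kappa>_pos \<kappa>_less
  have "0 < (1 - (1 - \<kappa>) * (px \<theta> 0)\<^sup>2) * (1 - (1 - \<kappa>) * (px \<theta> 1)\<^sup>2)"
    using b by (intro mult_pos_pos less_le_trans[OF \<kappa>_pos level_denom_ge]) auto
  then have "0 < 1 + W\<^sup>2 * \<kappa> / ((1 - (1 - \<kappa>) * (px \<theta> 0)\<^sup>2) * (1 - (1 - \<kappa>) * (px \<theta> 1)\<^sup>2))"
    using \<kappa>_pos by (intro add_pos_nonneg) auto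
  then have "px \<theta> 0 + px \<theta> 1 = 0"
    using chord_ends unfolding chord_def by (metis mult_eq_0_iff mult_zero_right less_irrefl)
  then show ?thesis by simp
qed

lemma px_start_pos: "0 < px \<theta> 0"
  using px_end px_strict_antimono[of 0 1] by simp

text \<open>The reflected profile \<open>pi - \<theta> (1 - x)\<close> has the same end angles, and
  without bias the speed depends on the angle only through \<open>(cos t)\<^sup>2\<close>; the
  comparison lemma then identifies it with \<theta>.\<close>

lemma reflection:
  assumes x: "x \<in> {0..1}"
  shows "\<theta> x = pi - \<theta> (1 - x)"
proof (rule slower_profile_eq[where f' = \<theta>' and g' = "\<lambda>x. \<theta>' (1 - x)", OF D1 _ \<theta>'_pos \<theta>'_pos _ _ _ x])
  fix x :: real assume x: "x \<in> {0..1}"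
  have "((\<lambda>x. 1 - x) has_real_derivative - 1) (at x within {0..1})"
    by (auto intro!: derivative_eq_intros)
  moreover have "(\<theta> has_real_derivative \<theta>' (1 - x)) (at (1 - x) within (\<lambda>x. 1 - x) ` {0..1})"
    by (rule DERIV_subset[OF D1]) (use x in auto)
  ultimately have "((\<lambda>x. \<theta> (1 - x)) has_real_derivative \<theta>' (1 - x) * - 1) (at x within {0..1})"
    using DERIV_image_chain[of \<theta> _ "\<lambda>x. 1 - x" x "{0..1}" "- 1"] by (simp add: o_def)
  then show "((\<lambda>x. pi - \<theta> (1 - x)) has_real_derivative \<theta>' (1 - x)) (at x within {0..1})"
    by (auto intro!: derivative_eq_intros)
next
  have "\<theta> 1 = pi - \<theta> 0"
    by (rule cos_inj_pi) (use px_end range[of 0] range[of 1] in \<open>auto simp: px_def\<close>)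
  then show "\<theta> 0 \<le> pi - \<theta> (1 - 0)" "pi - \<theta> (1 - 1) \<le> \<theta> 1" by auto
next
  fix x y :: real
  assume xy: "x \<in> {0..1}" "y \<in> {0..1}" and eq: "\<theta> x = pi - \<theta> (1 - y)"
  then have "elastic \<kappa> (\<theta> (1 - y)) * (\<theta>' x)\<^sup>2 = elastic \<kappa> (\<theta> (1 - y)) * (\<theta>' (1 - y))\<^sup>2"
    using speed_eq[of x] speed_eq[of "1 - y"] by (simp add: px_def elastic_eq)
  then have "(\<theta>' x)\<^sup>2 = (\<theta>' (1 - y))\<^sup>2"
    using elastic_pos[of "\<theta> (1 - y)"] by simp
  then show "\<theta>' x \<le> \<theta>' (1 - y)"
    using \<theta>'_pos[of x] \<theta>'_pos[of "1 - y"] xy by (simp add: power2_eq_iff)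
qed auto

lemma integral_px: "integral {0..1} (px \<theta>) = 0"
proof -
  have "px \<theta> integrable_on {0..1}"
    unfolding px_def by (intro integrable_continuous_interval continuous_intros cont)
  then have I: "(px \<theta> has_integral integral {0..1} (px \<theta>)) {0..1}"
    by (rule integrable_integral)
  have "(\<lambda>x. 1 - x) ` {0..1} = {0..1::real}"
    by simp
  then have "((\<lambda>x. px \<theta> (1 - x)) has_integral integral {0..1} (px \<theta>)) {0..1}"
    using has_integral_affinity[of "px \<theta>" _ 0 1 "- 1" 1] I by simp
  moreover have "px \<theta> (1 - x) = - px \<theta> x" if "x \<in> {0..1}" for x
    using reflection[OF that] by (simp add: px_def)
  ultimately have "((\<lambda>x. - px \<theta> x) has_integral integral {0..1} (px \<theta>)) {0..1}"
    using has_integral_eq[of "{0..1}" "\<lambda>x. px \<theta> (1 - x)" "\<lambda>x. - px \<theta> x"] by simp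
  from has_integral_unique[OF this has_integral_neg[OF I]] show ?thesis by linarith
qed

text \<open>Opposite end values force \<open>px\<close> to vanish somewhere. Positivity of the speed
  there says that the anchoring term of the level exceeds \<open>(px \<theta> 0)\<^sup>2\<close>,
  and that term is at most \<open>W\<^sup>2\<close>. This controls weak anchoring.\<close>

lemma px_start_less: "px \<theta> 0 < W"
proof -
  have "\<exists>x\<ge>0. x \<le> 1 \<and> px \<theta> x = 0"
    unfolding px_def using px_end px_start_pos
    by (intro IVT2' continuous_intros cont) (auto simp: px_def)
  then obtain x where x: "x \<in> {0..1}" "px \<theta> x = 0" by auto
  let ?p = "(px \<theta> 0)\<^sup>2"
  have "0 < 1 - (1 - \<kappa>) * ?p"
    using px_ends_bounds[of 0] \<kappa>_less by (intro less_le_trans[OF \<kappa>_pos level_denom_ge]) auto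
  moreover have "(1 - ?p) \<le> 1 - (1 - \<kappa>) * ?p"
    using \<kappa>_pos by (simp add: algebra_simps)
  ultimately have "(1 - ?p) / (1 - (1 - \<kappa>) * ?p) \<le> 1" by simp
  then have "W\<^sup>2 * ((1 - ?p) / (1 - (1 - \<kappa>) * ?p)) \<le> W\<^sup>2"
    by (intro mult_left_le) auto
  with speed_excess_pos[OF x(1)] have "?p < W\<^sup>2"
    by (simp add: level_def x(2))
  then show ?thesis
    using W_pos by (simp add: power2_less_imp_less)
qed

text \<open>Strong anchoring would make the profile too fast everywhere: the angle gains at most
  \<open>pi\<close> in unit time, so some point has speed at most \<open>pi\<close>. There the
  energy identity bounds \<open>W\<^sup>2 * (1 - (px \<theta> 0)\<^sup>2)\<close> by
  \<open>(pi / l)\<^sup>2 + 1\<close>, the 1 bounding the potential term.\<close>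

lemma px_start_gt: "1 - ((pi / l)\<^sup>2 + 1) / W\<^sup>2 < px \<theta> 0"
proof -
  obtain d z where dz: "0 < z" "z < 1" "(\<theta> has_real_derivative d) (at z)" "\<theta> 1 - \<theta> 0 = d"
    using MVT[of 0 1 \<theta>] cont(1) D1_at by (auto simp: real_differentiable_def)
  then have z: "0 < z" "z < 1" "\<theta>' z = \<theta> 1 - \<theta> 0"
    using DERIV_unique[OF D1_at] by auto
  have "\<theta>' z \<le> pi"
    using z range[of 0] range[of 1] by simp
  then have "(\<theta>' z)\<^sup>2 \<le> pi\<^sup>2"
    using \<theta>'_pos[of z] z by (intro power_mono) auto
  let ?p = "(px \<theta> 0)\<^sup>2"
  have denom: "0 < 1 - (1 - \<kappa>) * ?p"
    using px_ends_bounds[of 0] \<kappa>_less by (intro less_le_trans[OF \<kappa>_pos level_denom_ge]) auto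
  have p1: "?p < 1" using px_ends_bounds[of 0] by (simp add: abs_square_less_1)
  have "1 - ?p \<le> (1 - ?p) / (1 - (1 - \<kappa>) * ?p)"
    using p1 denom \<kappa>_less by (simp add: le_divide_eq mult_left_le)
  then have "W\<^sup>2 * (1 - ?p) \<le> W\<^sup>2 * ((1 - ?p) / (1 - (1 - \<kappa>) * ?p))"
    by (intro mult_left_mono) auto
  then have "W\<^sup>2 * (1 - ?p) - 1 < level W 0 \<kappa> (px \<theta> 0) - (1 - (px \<theta> z)\<^sup>2)"
    using p1 by (simp add: level_def)
      (smt (verit) zero_le_power2)
  then have "l\<^sup>2 * (W\<^sup>2 * (1 - ?p) - 1) < l\<^sup>2 * (level W 0 \<kappa> (px \<theta> 0) - (1 - (px \<theta> z)\<^sup>2))"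
    using l_pos by simp
  also have "\<dots> = elastic \<kappa> (\<theta> z) * (\<theta>' z)\<^sup>2"
    using speed_eq[of z] z by simp
  also have "\<dots> \<le> 1 * pi\<^sup>2"
    using \<open>(\<theta>' z)\<^sup>2 \<le> pi\<^sup>2\<close> elastic_pos[of "\<theta> z"] \<kappa>_less
    by (intro mult_mono) (auto simp: elastic_eq)
  finally have "W\<^sup>2 * (1 - ?p) < (pi / l)\<^sup>2 + 1"
    using l_pos by (simp add: power_divide field_simps)
  then have "1 - ?p < ((pi / l)\<^sup>2 + 1) / W\<^sup>2"
    using W_pos by (simp add: field_simps)
  moreover have "?p \<le> px \<theta> 0"
    using px_start_pos px_ends_bounds[of 0] by (simp add: power2_eq_square mult_left_le)
  ultimately show ?thesis by simp
qed

end

text \<open>Opposite end values turn a lower start directly into a higher end, and at a fixed value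
  of \<open>px\<close> stronger anchoring does not lower the level; the coefficients
  \<open>W1 * l\<close> and \<open>W2 * l\<close> would then have to be equal.\<close>

lemma px_start_strict_mono_anchoring:
  assumes P1: "unbiased_profile W1 l \<kappa> \<theta>1" and P2: "unbiased_profile W2 l \<kappa> \<theta>2"
    and less: "W1 < W2"
  shows "px \<theta>1 0 < px \<theta>2 0"
proof (rule ccontr)
  interpret P1: unbiased_profile W1 l \<kappa> \<theta>1 by (fact P1)
  interpret P2: unbiased_profile W2 l \<kappa> \<theta>2 by (fact P2)
  assume "\<not> ?thesis"
  then have le: "px \<theta>2 0 \<le> px \<theta>1 0" by simp
  let ?p = "(px \<theta>1 0)\<^sup>2"
  have "0 < 1 - (1 - \<kappa>) * ?p"
    using P1.px_ends_bounds[of 0] P1.\<kappa>_less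
    by (intro less_le_trans[OF P1.\<kappa>_pos level_denom_ge]) auto
  moreover have "?p < 1" using P1.px_ends_bounds[of 0] by (simp add: abs_square_less_1)
  moreover have "W1\<^sup>2 \<le> W2\<^sup>2" using less P1.W_pos by (intro power_mono) auto
  ultimately have "level W1 0 \<kappa> (px \<theta>1 0) \<le> level W2 0 \<kappa> (px \<theta>1 0)"
    unfolding level_def
    by (intro add_mono diff_mono divide_right_mono mult_right_mono order_refl) simp_all
  also have "\<dots> \<le> level W2 0 \<kappa> (px \<theta>2 0)"
    using P2.level_le_start[OF le] P1.px_ends_bounds[of 0] by simp
  finally have "W1 * l = W2 * l"
    using le P1.px_end P2.px_end
    by (intro profiles_coincide(2)[OF P1.nonconstant_profile_axioms P2.nonconstant_profile_axioms])
      (auto intro: mult_left_mono)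
  then show False using less P1.l_pos by simp
qed

theorem theorem2p8:
  fixes W E l \<kappa> :: real
  assumes "W > 0" "E \<ge> 0" "l \<ge> 1" "0 < \<kappa>" "\<kappa> < 1"
  shows
    "(\<forall>E1 E2 \<theta>1 \<theta>2. 0 \<le> E1 \<and> E1 < E2 \<and> cond_H W E1 l \<kappa> \<and> cond_H W E2 l \<kappa> \<and>
        nonconst_solution W E1 l \<kappa> \<theta>1 \<and> nonconst_solution W E2 l \<kappa> \<theta>2
        \<longrightarrow> px \<theta>1 0 < px \<theta>2 0) \<and>
     (\<forall>\<theta>. nonconst_solution W 0 l \<kappa> \<theta> \<longrightarrow> integral {0..1} (px \<theta>) = 0) \<and>
     tends_on (\<lambda>E'. nonconst_solution W E' l \<kappa>) (\<lambda>\<theta>. integral {0..1} (px \<theta>)) 1 at_top \<and>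

     (\<forall>W1 W2 \<theta>1 \<theta>2. 0 < W1 \<and> W1 < W2 \<and>
        nonconst_solution W1 0 l \<kappa> \<theta>1 \<and> nonconst_solution W2 0 l \<kappa> \<theta>2
        \<longrightarrow> px \<theta>1 0 < px \<theta>2 0 \<and> px \<theta>2 1 < px \<theta>1 1) \<and>
     tends_on (\<lambda>W'. nonconst_solution W' 0 l \<kappa>) (\<lambda>\<theta>. px \<theta> 0) 0 (at_right 0) \<and>
     tends_on (\<lambda>W'. nonconst_solution W' 0 l \<kappa>) (\<lambda>\<theta>. px \<theta> 0) 1 at_top \<and>
     tends_on (\<lambda>W'. nonconst_solution W' 0 l \<kappa>) (\<lambda>\<theta>. px \<theta> 1) 0 (at_right 0) \<and>
     tends_on (\<lambda>W'. nonconst_solution W' 0 l \<kappa>) (\<lambda>\<theta>. px \<theta> 1) (- 1) at_top \<and>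

     (\<forall>l1 l2 \<theta>1 \<theta>2. 1 \<le> l1 \<and> l1 < l2 \<and> cond_H W E l1 \<kappa> \<and> cond_H W E l2 \<kappa> \<and>
        nonconst_solution W E l1 \<kappa> \<theta>1 \<and> nonconst_solution W E l2 \<kappa> \<theta>2
        \<longrightarrow> px \<theta>1 0 < px \<theta>2 0 \<and> px \<theta>2 1 < px \<theta>1 1)"
proof (intro conjI allI impI)
  have profile: "nonconstant_profile W' E' l' \<kappa> \<theta>"
    if "nonconst_solution W' E' l' \<kappa> \<theta>" "0 < W'" "0 < l'" for W' E' l' \<theta>
    using that assms by unfold_locales auto
  have unbiased: "unbiased_profile W' l \<kappa> \<theta>"
    if "nonconst_solution W' 0 l \<kappa> \<theta>" "0 < W'" for W' \<theta>
    using profile[OF that] assms by (simp add: unbiased_profile_def)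
  show "px \<theta>1 0 < px \<theta>2 0"
    if "0 \<le> E1 \<and> E1 < E2 \<and> cond_H W E1 l \<kappa> \<and> cond_H W E2 l \<kappa> \<and>
      nonconst_solution W E1 l \<kappa> \<theta>1 \<and> nonconst_solution W E2 l \<kappa> \<theta>2" for E1 E2 \<theta>1 \<theta>2
    using px_start_strict_mono_field[OF profile profile] that assms by auto
  show "integral {0..1} (px \<theta>) = 0" if "nonconst_solution W 0 l \<kappa> \<theta>" for \<theta>
    using unbiased_profile.integral_px[OF unbiased[OF that]] assms by simp
  show "tends_on (\<lambda>E'. nonconst_solution W E' l \<kappa>) (\<lambda>\<theta>. integral {0..1} (px \<theta>)) 1 at_top"
  proof -
    \<comment> \<open>Vacuous: there are no nonconstant solutions once the field is large.\<close>
    have "\<not> nonconst_solution W E' l \<kappa> \<theta>" if "1 + W\<^sup>2 / \<kappa> \<le> E'" for E' \<theta>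
      using nonconstant_profile.field_bound[OF profile[of W E' l \<theta>]] that assms by auto
    then show ?thesis
      unfolding tends_on_def
      by (intro allI impI eventually_mono[OF eventually_ge_at_top[of "1 + W\<^sup>2 / \<kappa>"]]) auto
  qed
  show "px \<theta>1 0 < px \<theta>2 0" "px \<theta>2 1 < px \<theta>1 1"
    if "0 < W1 \<and> W1 < W2 \<and> nonconst_solution W1 0 l \<kappa> \<theta>1 \<and> nonconst_solution W2 0 l \<kappa> \<theta>2"
    for W1 W2 \<theta>1 \<theta>2
  proof -
    have P: "unbiased_profile W1 l \<kappa> \<theta>1" "unbiased_profile W2 l \<kappa> \<theta>2"
      using that by (auto intro!: unbiased)
    show "px \<theta>1 0 < px \<theta>2 0"
      using px_start_strict_mono_anchoring[OF P] that by simp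
    then show "px \<theta>2 1 < px \<theta>1 1"
      using P[THEN unbiased_profile.px_end] by simp
  qed
  have small: "\<forall>\<^sub>F W' in at_right 0. \<forall>\<theta>. nonconst_solution W' 0 l \<kappa> \<theta> \<longrightarrow> \<bar>px \<theta> 0\<bar> < \<epsilon>"
    if "0 < \<epsilon>" for \<epsilon>
    \<comment> \<open>The threshold is \<epsilon> itself, because
      \<open>0 < px \<theta> 0 < W'\<close>.\<close>
    using eventually_at_right_real[OF that]
  proof eventually_elim
    case (elim W')
    show ?case
    proof (intro allI impI)
      fix \<theta> assume "nonconst_solution W' 0 l \<kappa> \<theta>"
      then interpret unbiased_profile W' l \<kappa> \<theta>
        using elim by (intro unbiased) auto
      show "\<bar>px \<theta> 0\<bar> < \<epsilon>"
        using px_start_pos px_start_less elim by simp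
    qed
  qed
  have large: "\<forall>\<^sub>F W' in at_top. \<forall>\<theta>. nonconst_solution W' 0 l \<kappa> \<theta> \<longrightarrow> \<bar>px \<theta> 0 - 1\<bar> < \<epsilon>"
    if "0 < \<epsilon>" for \<epsilon>
  proof -
    have "((\<lambda>W'. ((pi / l)\<^sup>2 + 1) / W'\<^sup>2) \<longlongrightarrow> 0) at_top"
      by (intro real_tendsto_divide_at_top[OF tendsto_const] filterlim_pow_at_top filterlim_ident) auto
    from order_tendstoD(2)[OF this that] eventually_gt_at_top[of 0] show ?thesis
    proof eventually_elim
      case (elim W')
      show ?case
      proof (intro allI impI)
        fix \<theta> assume "nonconst_solution W' 0 l \<kappa> \<theta>"
        then interpret unbiased_profile W' l \<kappa> \<theta>
          using elim by (intro unbiased) auto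
        show "\<bar>px \<theta> 0 - 1\<bar> < \<epsilon>"
          using px_start_gt px_ends_bounds[of 0] elim by simp
      qed
    qed
  qed
  show "tends_on (\<lambda>W'. nonconst_solution W' 0 l \<kappa>) (\<lambda>\<theta>. px \<theta> 0) 0 (at_right 0)"
    using small by (simp add: tends_on_def)
  show "tends_on (\<lambda>W'. nonconst_solution W' 0 l \<kappa>) (\<lambda>\<theta>. px \<theta> 0) 1 at_top"
    using large by (simp add: tends_on_def)
  show "tends_on (\<lambda>W'. nonconst_solution W' 0 l \<kappa>) (\<lambda>\<theta>. px \<theta> 1) 0 (at_right 0)"
    unfolding tends_on_def
  proof (intro allI impI)
    fix \<epsilon> :: real assume "0 < \<epsilon>"
    from small[OF this] eventually_at_right_less[of 0]
    show "\<forall>\<^sub>F W' in at_right 0. \<forall>\<theta>. nonconst_solution W' 0 l \<kappa> \<theta> \<longrightarrow> \<bar>px \<theta> 1 - 0\<bar> < \<epsilon>"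
      by eventually_elim (simp add: unbiased_profile.px_end[OF unbiased])
  qed
  show "tends_on (\<lambda>W'. nonconst_solution W' 0 l \<kappa>) (\<lambda>\<theta>. px \<theta> 1) (- 1) at_top"
    unfolding tends_on_def
  proof (intro allI impI)
    fix \<epsilon> :: real assume "0 < \<epsilon>"
    from large[OF this] eventually_gt_at_top[of 0]
    show "\<forall>\<^sub>F W' in at_top. \<forall>\<theta>. nonconst_solution W' 0 l \<kappa> \<theta> \<longrightarrow> \<bar>px \<theta> 1 - - 1\<bar> < \<epsilon>"
      by eventually_elim (simp add: unbiased_profile.px_end[OF unbiased] abs_minus_commute)
  qed
  show "px \<theta>1 0 < px \<theta>2 0" "px \<theta>2 1 < px \<theta>1 1"
    if "1 \<le> l1 \<and> l1 < l2 \<and> cond_H W E l1 \<kappa> \<and> cond_H W E l2 \<kappa> \<and>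
      nonconst_solution W E l1 \<kappa> \<theta>1 \<and> nonconst_solution W E l2 \<kappa> \<theta>2" for l1 l2 \<theta>1 \<theta>2
    using that assms
    by (auto intro!: px_ends_strict_mono_length[OF profile profile, of W E l1 \<theta>1 l2 \<theta>2])
qed

end
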